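(* For a prime $p$ and $n\in\mathbb{N}$, let $C^{\mathrm{pr}}_{n,p}$ denote the size of the largest projective cap in $\mathrm{PG}(n,p)$. Then $$C^{\mathrm{pr}}_{n,11}\gg \frac{5^{n}}{n^{1.5}},\quad C^{\mathrm{pr}}_{n,17}\gg \frac{7^{n}}{n^{2.5}},\quad C^{\mathrm{pr}}_{n,23}\gg \frac{9^{n}}{n^{3.5}},\quad C^{\mathrm{pr}}_{n,29}\gg \frac{10^{n}}{n^{4}}\quad\text{and}\quad C^{\mathrm{pr}}_{n,41}\gg \frac{12^{n}}{n^{5}}.$$ As a consequence, $\liminf_{n\to\infty}(C^{\mathrm{pr}}_{n,p})^{1/n}$ is at least $5$, $7$, $9$, $10$, $12$ for $p=11$, $17$, $23$, $29$, $41$, respectively.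
   Context: For a prime $p$, $\mathrm{PG}(n,p)$ is the $n$-dimensional projective space over the field $\mathbb{Z}_p=\mathbb{Z}/p\mathbb{Z}$, i.e., its points are the one-dimensional linear subspaces of $\mathbb{Z}_p^{n+1}$. A projective cap is a set of points of $\mathrm{PG}(n,p)$ no three (pairwise distinct) of which lie on a common projective line. Vinogradov notation: $f(n)\gg g(n)$ means that there exist $C>0$ and $n_0$ such that $f(n)\geq C\,g(n)$ for all $n>n_0$. *)

theory Defs
  imports Complex_Main "HOL-Library.Liminf_Limsup" "HOL-Library.Extended_Real"
    "HOL-Number_Theory.Residues" "Jordan_Normal_Form.Missing_VectorSpace"
begin

text \<open>
  The vector space of \<open>(n + 1)\<close>-tuples over the integers modulo \<open>p\<close>, with coordinates indexed by
  \<open>0, \<dots>, n\<close>. The definitions below are meaningful for prime \<open>p\<close>, when \<open>residue_ring (int p)\<close>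
  is a field.
\<close>

definition coord_space :: "nat \<Rightarrow> nat \<Rightarrow> (int, nat \<Rightarrow> int) module" where
  "coord_space n p = ring.func_space (residue_ring (int p)) {0..n}"

definition subspaces_of_dim :: "nat \<Rightarrow> nat \<Rightarrow> nat \<Rightarrow> (nat \<Rightarrow> int) set set" where
  "subspaces_of_dim d n p =
     {W. subspace (residue_ring (int p)) W (coord_space n p) \<and>
         vectorspace.dim (residue_ring (int p)) ((coord_space n p)\<lparr>carrier := W\<rparr>) = d}"

definition PG_points :: "nat \<Rightarrow> nat \<Rightarrow> (nat \<Rightarrow> int) set set" where
  "PG_points n p = subspaces_of_dim 1 n p"

text \<open>A projective line is represented by the plane through the origin that contains its points.\<close>

definition PG_lines :: "nat \<Rightarrow> nat \<Rightarrow> (nat \<Rightarrow> int) set set" where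
  "PG_lines n p = subspaces_of_dim 2 n p"

definition projective_cap :: "nat \<Rightarrow> nat \<Rightarrow> (nat \<Rightarrow> int) set set \<Rightarrow> bool" where
  "projective_cap n p S \<longleftrightarrow>
     S \<subseteq> PG_points n p \<and>
     (\<forall>P\<in>S. \<forall>Q\<in>S. \<forall>R\<in>S. P \<noteq> Q \<and> P \<noteq> R \<and> Q \<noteq> R \<longrightarrow>
        \<not> (\<exists>L\<in>PG_lines n p. P \<subseteq> L \<and> Q \<subseteq> L \<and> R \<subseteq> L))"

definition max_cap :: "nat \<Rightarrow> nat \<Rightarrow> nat" where
  "max_cap n p = Max {card S | S. projective_cap n p S}"

definition vinogradov_gg :: "(nat \<Rightarrow> real) \<Rightarrow> (nat \<Rightarrow> real) \<Rightarrow> bool" (infix "\<ggreater>" 50) where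
  "f \<ggreater> g \<longleftrightarrow> (\<exists>C>0. \<exists>n0. \<forall>n>n0. f n \<ge> C * g n)"

text \<open>For prime \<open>p\<close> the maximum is taken over a finite nonempty set.\<close>

lemma coord_space_vectorspace:
  assumes "prime p"
  shows "vectorspace (residue_ring (int p)) (coord_space n p)"
proof -
  interpret residues_prime p "residue_ring (int p)"
    using assms by unfold_locales auto
  show ?thesis
    unfolding vectorspace_def coord_space_def
    using is_field func_space_is_module[of "{0..n}"] by simp
qed

lemma finite_PG_points:
  assumes "prime p"
  shows "finite (PG_points n p)"
proof -
  interpret residues_prime p "residue_ring (int p)"
    using assms by unfold_locales auto
  have "carrier (coord_space n p) = {0..n} \<rightarrow>\<^sub>E carrier (residue_ring (int p))"
    by (simp add: coord_space_def func_space_def)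
  then have "finite (carrier (coord_space n p))"
    by (simp add: finite_PiE)
  moreover have "PG_points n p \<subseteq> Pow (carrier (coord_space n p))"
    by (auto simp: PG_points_def subspaces_of_dim_def subspace_def submodule_def)
  ultimately show ?thesis
    by (meson finite_Pow_iff finite_subset)
qed

lemma max_cap_attained:
  assumes "prime p"
  shows "\<exists>S. projective_cap n p S \<and> card S = max_cap n p"
    and "projective_cap n p S \<Longrightarrow> card S \<le> max_cap n p"
proof -
  let ?A = "{card S | S. projective_cap n p S}"
  have "{S. projective_cap n p S} \<subseteq> Pow (PG_points n p)"
    by (auto simp: projective_cap_def)
  then have "finite {S. projective_cap n p S}"
    using finite_PG_points[OF assms] by (meson finite_Pow_iff finite_subset)
  then have fin: "finite ?A" by simp
  have "projective_cap n p {}" by (simp add: projective_cap_def)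
  then have "?A \<noteq> {}" by blast
  from Max_in[OF fin this] show "\<exists>S. projective_cap n p S \<and> card S = max_cap n p"
    unfolding max_cap_def by auto
  show "projective_cap n p S \<Longrightarrow> card S \<le> max_cap n p"
    unfolding max_cap_def using fin by (auto intro: Max_ge)
qed

end

theory Submission
  imports Defs "HOL-Real_Asymp.Real_Asymp"
begin

text \<open>
  Fix a set \<open>D\<close> of \<open>k\<close> digits modulo \<open>p\<close> and consider the points with coordinates
  \<open>(1, x\<^sub>1, \<dots>, x\<^sub>n)\<close>, \<open>x\<^sub>i \<in> D\<close>, in which all but two of the digits occur with prescribed
  multiplicities. By Chebyshev's inequality a positive proportion of the words have
  all these multiplicities within \<open>\<surd>n\<close> of the mean, so by the pigeonhole principle some choice of the \<open>k - 2\<close> multiplicities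
  leaves at least a constant times \<open>k\<^sup>n / n\<^bsup>(k - 2) / 2\<^esup>\<close> points. If three distinct such points are
  collinear, then \<open>z = (1 - t) x + t y\<close> for some \<open>t\<close> other than \<open>0, 1\<close>. Suppose that \<open>u\<close> and \<open>v\<close>
  are integer weights that vanish on the two exceptional digits and satisfy
  \<open>u(a) - u(c) + v(b) - v(c) > 0\<close> whenever \<open>c = (1 - t) a + t b\<close> holds for digits \<open>a, b, c\<close> that are not
  all equal. Summing over the coordinates gives zero because the multiplicities agree, so every
  coordinate is constant on the three points, a contradiction. Suitable \<open>D\<close>, \<open>u\<close>, \<open>v\<close> are
  exhibited for each of the five primes.
\<close>

section \<open>Points and lines of the projective space\<close>

text \<open>Coordinate 0 is normalised to 1, which makes the representing vector of a projective
  point unique. The \<open>restrict\<close> is needed because the vectors of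
  \<open>coord_space\<close> are extensional functions.\<close>

definition embed :: "nat \<Rightarrow> int list \<Rightarrow> nat \<Rightarrow> int" where
  "embed n xs = restrict (\<lambda>i. (1 # xs) ! i) {0..n}"

definition proj_point :: "nat \<Rightarrow> nat \<Rightarrow> int list \<Rightarrow> (nat \<Rightarrow> int) set" where
  "proj_point n p xs = module.span (residue_ring (int p)) (coord_space n p) {embed n xs}"

context
  fixes p n :: nat
  assumes prime: "prime p"
begin

interpretation R: residues_prime p "residue_ring (int p)"
  using prime by unfold_locales auto

interpretation V: vectorspace "residue_ring (int p)" "coord_space n p"
  using coord_space_vectorspace[OF prime] .

lemma carrier_coord_space: "carrier (coord_space n p) = {0..n} \<rightarrow>\<^sub>E {0..<int p}"
  by (auto simp: coord_space_def R.func_space_def R.res_carrier_eq)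

lemma smult_coord_space:
  "c \<odot>\<^bsub>coord_space n p\<^esub> f = (\<lambda>i\<in>{0..n}. (c * f i) mod int p)"
  by (simp add: coord_space_def R.func_space_def R.res_mult_eq)

lemma add_coord_space:
  "f \<oplus>\<^bsub>coord_space n p\<^esub> g = (\<lambda>i\<in>{0..n}. (f i + g i) mod int p)"
  by (simp add: coord_space_def R.func_space_def R.res_add_eq)

lemma zero_coord_space: "\<zero>\<^bsub>coord_space n p\<^esub> = (\<lambda>i\<in>{0..n}. 0)"
  by (simp add: coord_space_def R.func_space_def R.res_zero_eq)

lemma embed_carrier:
  assumes "set xs \<subseteq> {0..<int p}" "length xs = n"
  shows "embed n xs \<in> carrier (coord_space n p)"
proof -
  have "(1 # xs) ! i \<in> {0..<int p}" if "i \<le> n" for i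
  proof -
    have "(1 # xs) ! i \<in> set (1 # xs)" using that assms(2) by (intro nth_mem) auto
    then show ?thesis using assms(1) prime_gt_1_nat[OF prime] by auto
  qed
  then show ?thesis by (auto simp: carrier_coord_space embed_def)
qed

lemma embed_neq_zero: "embed n xs \<noteq> \<zero>\<^bsub>coord_space n p\<^esub>"
  by (auto simp: embed_def zero_coord_space dest!: fun_cong[of _ _ 0])

lemma embed_in_proj_point:
  assumes "set xs \<subseteq> {0..<int p}" "length xs = n"
  shows "embed n xs \<in> proj_point n p xs"
  using V.span_mem[of "{embed n xs}"] embed_carrier[OF assms] by (simp add: proj_point_def)

lemma proj_point_in_PG_points:
  assumes "set xs \<subseteq> {0..<int p}" "length xs = n"
  shows "proj_point n p xs \<in> PG_points n p"
proof -
  let ?v = "embed n xs"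
  have v: "?v \<in> carrier (coord_space n p)" using embed_carrier[OF assms] .
  have sub: "subspace (residue_ring (int p)) (V.span {?v}) (coord_space n p)"
    using v by (intro V.span_is_subspace) auto
  interpret W: vectorspace "residue_ring (int p)" "V.vs (V.span {?v})"
    by (rule V.subspace_is_vs[OF sub])
  have mem: "?v \<in> V.span {?v}" using embed_in_proj_point[OF assms] by (simp add: proj_point_def)
  have "W.span {?v} = V.span {?v}"
    using V.span_li_not_depend(1)[of "{?v}" "V.span {?v}"] mem sub by (simp add: subspace_def)
  then have "W.dim = 1"
    using mem embed_neq_zero[of xs] by (intro W.dim1I[of ?v]) auto
  then show ?thesis using sub by (simp add: PG_points_def subspaces_of_dim_def proj_point_def)
qed

text \<open>One vector is a scalar multiple of the other, and comparing coordinate 0 forces the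
  scalar to be 1.\<close>

lemma proj_point_eqD:
  assumes "set xs \<subseteq> {0..<int p}" "length xs = n" "set ys \<subseteq> {0..<int p}" "length ys = n"
    and "proj_point n p xs = proj_point n p ys"
  shows "xs = ys"
proof -
  let ?v = "embed n ys"
  have v: "?v \<in> carrier (coord_space n p)" using embed_carrier[OF assms(3,4)] .
  have "embed n xs \<in> V.span {?v}"
    using embed_in_proj_point[OF assms(1,2)] assms(5) by (simp add: proj_point_def)
  then obtain a A where A: "A \<subseteq> {?v}" "a \<in> A \<rightarrow> carrier (residue_ring (int p))" "embed n xs = V.lincomb a A"
    by (auto simp: V.span_def)
  have "A \<noteq> {}" using A embed_neq_zero[of xs] by auto
  then have "A = {?v}" using A by auto
  then have eq: "embed n xs = a ?v \<odot>\<^bsub>coord_space n p\<^esub> ?v"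
    using A v by (simp add: V.lincomb_def)
  from fun_cong[OF eq, of 0] have a: "a ?v mod int p = 1" 
    by (simp add: embed_def smult_coord_space)
  show ?thesis
  proof (rule nth_equalityI)
    fix i assume i: "i < length xs"
    then have r: "xs ! i \<in> {0..<int p}" "ys ! i \<in> {0..<int p}" using assms(1-4) by (auto simp: subset_iff)
    from fun_cong[OF eq, of "Suc i"] i have "xs ! i = (a ?v * ys ! i) mod int p"
      using assms by (simp add: embed_def smult_coord_space)
    also have "\<dots> = (a ?v mod int p) * ys ! i mod int p" by (simp add: mod_mult_left_eq)
    also have "\<dots> = ys ! i" using a r by simp
    finally show "xs ! i = ys ! i" .
  qed (use assms in auto)
qed

text \<open>Three distinct vectors in a plane are linearly dependent. Coordinate 0 of the relation
  says that the coefficients sum to zero, the other coordinates give the relation between the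
  words.\<close>

lemma collinear_imp_dependent:
  assumes xs: "set xs \<subseteq> {0..<int p}" "length xs = n" and ys: "set ys \<subseteq> {0..<int p}" "length ys = n"
    and zs: "set zs \<subseteq> {0..<int p}" "length zs = n"
    and neq: "xs \<noteq> ys" "xs \<noteq> zs" "ys \<noteq> zs"
    and L: "L \<in> PG_lines n p" "proj_point n p xs \<subseteq> L" "proj_point n p ys \<subseteq> L" "proj_point n p zs \<subseteq> L"
  obtains a b c where "[a + b + c = 0] (mod int p)"
    "\<And>i. i < n \<Longrightarrow> [a * xs ! i + b * ys ! i + c * zs ! i = 0] (mod int p)"
    "\<not> int p dvd a \<or> \<not> int p dvd b \<or> \<not> int p dvd c"
proof -
  let ?x = "embed n xs" and ?y = "embed n ys" and ?z = "embed n zs"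
  let ?S = "{?x, ?y, ?z}"
  have car: "?x \<in> carrier (coord_space n p)" "?y \<in> carrier (coord_space n p)" "?z \<in> carrier (coord_space n p)"
    using embed_carrier xs ys zs by auto
  \<comment> \<open>Equal vectors would span equal points. Distinctness ensures that
    \<open>?S\<close> has three elements, more than the dimension of the line.\<close>
  have dist: "?x \<noteq> ?y" "?x \<noteq> ?z" "?y \<noteq> ?z"
    using neq proj_point_eqD xs ys zs unfolding proj_point_def by metis+
  have mem: "?S \<subseteq> L" using L embed_in_proj_point xs ys zs by blast
  have sub: "subspace (residue_ring (int p)) L (coord_space n p)"
    and dim: "vectorspace.dim (residue_ring (int p)) (V.vs L) = 2"
    using L(1) by (auto simp: PG_lines_def subspaces_of_dim_def)
  interpret W: vectorspace "residue_ring (int p)" "V.vs L"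
    by (rule V.subspace_is_vs[OF sub])
  have "finite (carrier (coord_space n p))" by (simp add: carrier_coord_space finite_PiE)
  then have "finite L" using sub by (auto simp: subspace_def submodule_def intro: finite_subset)
  then have "W.fin_dim"
    unfolding W.fin_dim_def using W.span_mem[of L] W.span_closed[of L] by (intro exI[of _ L]) auto
  then have "\<not> W.lin_indpt ?S"
    using W.li_le_dim(2)[of ?S] mem dim dist by auto
  then have "V.lin_dep ?S"
    using V.span_li_not_depend(2)[of ?S L] mem sub by (simp add: subspace_def)
  then obtain a where a: "a \<in> ?S \<rightarrow> carrier (residue_ring (int p))"
      "V.lincomb a ?S = \<zero>\<^bsub>coord_space n p\<^esub>" "\<exists>v\<in>?S. a v \<noteq> \<zero>\<^bsub>residue_ring (int p)\<^esub>"
    using V.finite_lin_indpt2[of ?S] car by blast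
  have "V.lincomb a ?S = a ?x \<odot>\<^bsub>coord_space n p\<^esub> ?x \<oplus>\<^bsub>coord_space n p\<^esub>
      (a ?y \<odot>\<^bsub>coord_space n p\<^esub> ?y \<oplus>\<^bsub>coord_space n p\<^esub> a ?z \<odot>\<^bsub>coord_space n p\<^esub> ?z)"
    using a(1) car dist by (simp add: V.lincomb_def V.finsum_insert Pi_iff)
  then have eq: "a ?x \<odot>\<^bsub>coord_space n p\<^esub> ?x \<oplus>\<^bsub>coord_space n p\<^esub>
      (a ?y \<odot>\<^bsub>coord_space n p\<^esub> ?y \<oplus>\<^bsub>coord_space n p\<^esub> a ?z \<odot>\<^bsub>coord_space n p\<^esub> ?z) = \<zero>\<^bsub>coord_space n p\<^esub>"
    using a(2) by simp
  have eqi: "[a ?x * ?x i + a ?y * ?y i + a ?z * ?z i = 0] (mod int p)" if "i \<le> n" for i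
  proof -
    have "(a ?x * ?x i mod int p + (a ?y * ?y i mod int p + a ?z * ?z i mod int p) mod int p) mod int p = 0"
      using fun_cong[OF eq, of i] that
      by (simp only: smult_coord_space add_coord_space zero_coord_space restrict_apply' atLeastAtMost_iff le0 simp_thms)
    then show ?thesis by (simp add: unique_euclidean_semiring_class.cong_def mod_simps add.assoc)
  qed
  have nz: "\<not> int p dvd a v" if "v \<in> ?S" "a v \<noteq> \<zero>\<^bsub>residue_ring (int p)\<^esub>" for v
  proof
    assume "int p dvd a v"
    moreover have "0 \<le> a v" "a v < int p" using a(1) that(1) by (auto simp: R.res_carrier_eq)
    ultimately have "a v = 0" using zdvd_imp_le by fastforce
    then show False using that by (simp add: R.res_zero_eq)
  qed
  show ?thesis
  proof (rule that[of "a ?x" "a ?y" "a ?z"])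
    show "[a ?x + a ?y + a ?z = 0] (mod int p)" using eqi[of 0] by (simp add: embed_def)
    show "[a ?x * xs ! i + a ?y * ys ! i + a ?z * zs ! i = 0] (mod int p)" if "i < n" for i
      using eqi[of "Suc i"] that by (simp add: embed_def)
    show "\<not> int p dvd a ?x \<or> \<not> int p dvd a ?y \<or> \<not> int p dvd a ?z"
      using a(3) nz by blast
  qed
qed

end

section \<open>Words with prescribed multiplicities\<close>

text \<open>This is the variance of a binomial variable with parameters \<open>n\<close> and
  \<open>1 / k\<close>, cleared of denominators. Let \<open>Y\<close> be the deviation being
  squared. Prepending \<open>d\<close> changes \<open>Y\<close> by \<open>k - 1\<close>, any other
  letter by \<open>-1\<close>. These changes sum to zero over \<open>D\<close>, so the cross terms
  cancel, and their squares sum to \<open>k * (k - 1)\<close>.\<close>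

lemma sum_sq_count_list:
  fixes D :: "'a set"
  assumes "finite D" "d \<in> D"
  defines "k \<equiv> real (card D)"
  shows "(\<Sum>xs | set xs \<subseteq> D \<and> length xs = n. (k * real (count_list xs d) - real n)\<^sup>2)
         = real n * (k - 1) * k ^ n"
proof (induction n)
  case 0
  have "{xs. set xs \<subseteq> D \<and> length xs = 0} = {[]}" by auto
  then show ?case by simp
next
  case (Suc n)
  let ?L = "{xs. set xs \<subseteq> D \<and> length xs = n}"
  let ?Y = "\<lambda>xs. k * real (count_list xs d) - real n"
  have fin: "finite ?L" using assms(1) by (rule finite_lists_length_eq)
  have cL: "real (card ?L) = k ^ n"
    using card_lists_length_eq[OF assms(1), of n] by (simp add: k_def)
  have inj: "inj_on (\<lambda>p. fst p # snd p) (D \<times> ?L)" by (auto simp: inj_on_def)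
  have "{xs. set xs \<subseteq> D \<and> length xs = Suc n} = (\<lambda>p. fst p # snd p) ` (D \<times> ?L)"
    by (auto simp: length_Suc_conv image_iff)
  then have "(\<Sum>xs | set xs \<subseteq> D \<and> length xs = Suc n. (k * real (count_list xs d) - real (Suc n))\<^sup>2)
      = (\<Sum>(x, xs)\<in>D \<times> ?L. (k * real (count_list (x # xs) d) - real (Suc n))\<^sup>2)"
    by (simp only: sum.reindex[OF inj] comp_def case_prod_unfold)
  also have "\<dots> = (\<Sum>xs\<in>?L. \<Sum>x\<in>D. (k * real (count_list (x # xs) d) - real (Suc n))\<^sup>2)"
    by (subst sum.swap) (simp add: sum.cartesian_product)
  also have "\<dots> = (\<Sum>xs\<in>?L. k * (?Y xs)\<^sup>2 + k * (k - 1))"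
  proof (rule sum.cong[OF refl])
    fix xs
    have "(\<Sum>x\<in>D. (k * real (count_list (x # xs) d) - real (Suc n))\<^sup>2)
        = (?Y xs + (k - 1))\<^sup>2 + (\<Sum>x\<in>D - {d}. (?Y xs - 1)\<^sup>2)"
      using assms by (subst sum.remove[of D d]) (auto simp: algebra_simps intro!: sum.cong)
    also have "(\<Sum>x\<in>D - {d}. (?Y xs - 1)\<^sup>2) = (k - 1) * (?Y xs - 1)\<^sup>2"
    proof -
      have "card D \<ge> 1" using assms by (metis One_nat_def Suc_leI card_gt_0_iff empty_iff)
      then show ?thesis using assms by (simp add: of_nat_diff)
    qed
    finally show "(\<Sum>x\<in>D. (k * real (count_list (x # xs) d) - real (Suc n))\<^sup>2) = k * (?Y xs)\<^sup>2 + k * (k - 1)"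
      by (simp add: power2_eq_square algebra_simps)
  qed
  also have "\<dots> = k * (real n * (k - 1) * k ^ n) + k ^ n * (k * (k - 1))"
    by (simp add: sum.distrib sum_distrib_left[symmetric] Suc.IH cL)
  finally show ?case by (simp add: algebra_simps)
qed

text \<open>Chebyshev's inequality. The proportion \<open>1 / k\<close> is small enough for a union
  bound over \<open>k - 1\<close> digits.\<close>

lemma card_count_deviation:
  fixes D :: "'a set"
  assumes "finite D" "d \<in> D" "n > 0"
  defines "k \<equiv> real (card D)"
  shows "real (card {xs. set xs \<subseteq> D \<and> length xs = n \<and> \<bar>real (count_list xs d) - real n / k\<bar> \<ge> sqrt n}) \<le> k ^ n / k"
proof -
  let ?L = "{xs. set xs \<subseteq> D \<and> length xs = n}"
  let ?B = "{xs \<in> ?L. \<bar>real (count_list xs d) - real n / k\<bar> \<ge> sqrt n}"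
  have fin: "finite ?L" using assms(1) by (rule finite_lists_length_eq)
  have k: "k \<ge> 1" using assms by (auto simp: k_def Suc_le_eq card_gt_0_iff)
  have "real (card ?B) * (k\<^sup>2 * real n) = (\<Sum>xs\<in>?B. k\<^sup>2 * real n)" by simp
  also have "\<dots> \<le> (\<Sum>xs\<in>?B. (k * real (count_list xs d) - real n)\<^sup>2)"
  proof (rule sum_mono)
    fix xs assume "xs \<in> ?B"
    then have "(sqrt n)\<^sup>2 \<le> \<bar>real (count_list xs d) - real n / k\<bar>\<^sup>2" by (intro power_mono) auto
    then have "k\<^sup>2 * real n \<le> k\<^sup>2 * (real (count_list xs d) - real n / k)\<^sup>2" 
      by (intro mult_left_mono) auto
    also have "\<dots> = (k * real (count_list xs d) - real n)\<^sup>2"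
      using k by (simp add: power_mult_distrib[symmetric] right_diff_distrib)
    finally show "k\<^sup>2 * real n \<le> (k * real (count_list xs d) - real n)\<^sup>2" .
  qed
  also have "\<dots> \<le> (\<Sum>xs\<in>?L. (k * real (count_list xs d) - real n)\<^sup>2)"
    by (rule sum_mono2[OF fin]) auto
  also have "\<dots> = real n * (k - 1) * k ^ n"
    using sum_sq_count_list[OF assms(1,2)] by (simp add: k_def)
  also have "\<dots> \<le> real n * k * k ^ n" using k by (intro mult_right_mono mult_left_mono) auto
  finally have "real (card ?B) * k\<^sup>2 \<le> k * k ^ n" using assms(3) by (simp add: mult.commute mult.left_commute)
  then have "real (card ?B) \<le> k ^ n / k" using k by (simp add: field_simps power2_eq_square)
  then show ?thesis by (simp add: conj_assoc)
qed

text \<open>From the least element on, the set fits into a block of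
  \<open>\<lceil>2 * r\<rceil>\<close> integers; the hypothesis \<open>r \<ge> 1\<close> absorbs the
  rounding error.\<close>

lemma card_nat_near:
  fixes a r :: real
  assumes "r \<ge> 1"
  defines "I \<equiv> {c :: nat. \<bar>real c - a\<bar> < r}"
  shows "finite I" "real (card I) \<le> 3 * r"
proof -
  have "finite I \<and> real (card I) \<le> 3 * r"
  proof (cases "I = {}")
    case False
    define m where "m = (LEAST c. c \<in> I)"
    have m: "m \<in> I" "\<And>c. c \<in> I \<Longrightarrow> m \<le> c"
      using False unfolding m_def by (auto intro: LeastI Least_le)
    have sub: "I \<subseteq> {m..<m + nat \<lceil>2 * r\<rceil>}"
    proof
      fix c assume "c \<in> I"
      then have "m \<le> c" "real c - real m < 2 * r" using m unfolding I_def by auto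
      then have "real (c - m) < real (nat \<lceil>2 * r\<rceil>)" by linarith
      then show "c \<in> {m..<m + nat \<lceil>2 * r\<rceil>}" using \<open>m \<le> c\<close> by auto
    qed
    have "real (card I) \<le> real (nat \<lceil>2 * r\<rceil>)" using card_mono[OF _ sub] by simp
    also have "\<dots> \<le> 2 * r + 1" using assms(1) by linarith
    finally show ?thesis using assms(1) finite_subset[OF sub] by auto
  qed (use assms(1) in auto)
  then show "finite I" "real (card I) \<le> 3 * r" by auto
qed

lemma exists_large_count_class:
  fixes D E :: "'a set"
  assumes "finite D" "E \<subseteq> D" "card E < card D" "n > 0"
  defines "k \<equiv> real (card D)"
  obtains S where "S \<subseteq> {xs. set xs \<subseteq> D \<and> length xs = n}"
    "\<And>xs ys d. xs \<in> S \<Longrightarrow> ys \<in> S \<Longrightarrow> d \<in> E \<Longrightarrow> count_list xs d = count_list ys d"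
    "k ^ n / k \<le> real (card S) * (3 * sqrt n) ^ card E"
proof -
  let ?L = "{xs. set xs \<subseteq> D \<and> length xs = n}"
  define B where "B = (\<lambda>d. {xs. set xs \<subseteq> D \<and> length xs = n \<and> \<bar>real (count_list xs d) - real n / k\<bar> \<ge> sqrt n})"
  define G where "G = ?L - (\<Union>d\<in>E. B d)"
  define I where "I = {c :: nat. \<bar>real c - real n / k\<bar> < sqrt n}"
  \<comment> \<open>Restricting to \<open>E\<close> makes the vector of multiplicities an element of
    a finite product, so that its values can be counted.\<close>
  define \<phi> where "\<phi> = (\<lambda>xs. restrict (count_list xs) E)"
  have finL: "finite ?L" using assms(1) by (rule finite_lists_length_eq)
  have finE: "finite E" using assms(1,2) finite_subset by blast
  have finI: "finite I" and cI: "real (card I) \<le> 3 * sqrt n"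
    using card_nat_near[of "sqrt n" "real n / k"] assms(4) unfolding I_def by auto
  have k: "k > 0" using assms(3) by (simp add: k_def)
  have BL: "(\<Union>d\<in>E. B d) \<subseteq> ?L" by (auto simp: B_def)
  have "real (card (\<Union>d\<in>E. B d)) \<le> (\<Sum>d\<in>E. real (card (B d)))"
    using card_UN_le[OF finE, of B] by (simp flip: of_nat_sum)
  also have "\<dots> \<le> (\<Sum>d\<in>E. k ^ n / k)"
    using card_count_deviation[OF assms(1) _ assms(4)] assms(2)
    unfolding B_def k_def by (intro sum_mono) auto
  also have "\<dots> = card E * (k ^ n / k)" by simp
  \<comment> \<open>As \<open>E\<close> omits at least one digit, the exceptional words leave at
    least a proportion \<open>1 / k\<close> of all words.\<close>
  also have "\<dots> \<le> (k - 1) * (k ^ n / k)"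
    using assms(3) k by (intro mult_right_mono) (auto simp: k_def)
  finally have "real (card (\<Union>d\<in>E. B d)) \<le> k ^ n - k ^ n / k" using k by (simp add: field_simps)
  moreover have "real (card G) = k ^ n - real (card (\<Union>d\<in>E. B d))"
    using card_lists_length_eq[OF assms(1), of n] card_mono[OF finL BL] finite_subset[OF BL finL] 
    unfolding G_def by (simp add: card_Diff_subset[OF _ BL] of_nat_diff k_def)
  ultimately have G: "k ^ n / k \<le> real (card G)" by simp
  let ?P = "E \<rightarrow>\<^sub>E I"
  have finP: "finite ?P" using finE finI by (simp add: finite_PiE)
  have sub: "\<phi> ` G \<subseteq> ?P" by (auto simp: \<phi>_def G_def B_def I_def)
  have "k ^ n / k > 0" using k by simp
  then have "G \<noteq> {}" using G by auto
  then have ne: "\<phi> ` G \<noteq> {}" and finG: "finite (\<phi> ` G)"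
    using finite_subset[OF sub finP] by auto
  \<comment> \<open>Pigeonhole principle: the largest fibre of \<open>\<phi>\<close> is the class
    sought.\<close>
  define M where "M = Max ((\<lambda>c. card {xs \<in> G. \<phi> xs = c}) ` \<phi> ` G)"
  have "M \<in> (\<lambda>c. card {xs \<in> G. \<phi> xs = c}) ` \<phi> ` G"
    unfolding M_def using ne finG by (intro Max_in) auto
  then obtain c where c: "M = card {xs \<in> G. \<phi> xs = c}" by auto
  have "G = (\<Union>c\<in>\<phi> ` G. {xs \<in> G. \<phi> xs = c})" by auto
  then have "card G \<le> (\<Sum>c\<in>\<phi> ` G. card {xs \<in> G. \<phi> xs = c})"
    using card_UN_le[OF finG, of "\<lambda>c. {xs \<in> G. \<phi> xs = c}"] by metis
  also have "\<dots> \<le> card (\<phi> ` G) * M"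
    using sum_bounded_above[of "\<phi> ` G" "\<lambda>c. card {xs \<in> G. \<phi> xs = c}" M] finG by (simp add: M_def)
  also have "\<dots> \<le> card ?P * M" using card_mono[OF finP sub] by simp
  also have "\<dots> = card I ^ card E * M" using finE by (simp add: card_PiE)
  finally have "real (card G) \<le> real (card I) ^ card E * real M"
    by (metis of_nat_le_iff of_nat_mult of_nat_power)
  also have "\<dots> \<le> (3 * sqrt n) ^ card E * real M"
    using cI by (intro mult_right_mono power_mono) auto
  finally have "k ^ n / k \<le> real (card {xs \<in> G. \<phi> xs = c}) * (3 * sqrt n) ^ card E"
    using G c by (simp add: mult.commute)
  moreover have "count_list xs d = count_list ys d"
    if "xs \<in> {xs \<in> G. \<phi> xs = c}" "ys \<in> {xs \<in> G. \<phi> xs = c}" "d \<in> E" for xs ys d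
    using that by (auto simp: \<phi>_def restrict_def dest!: fun_cong[of _ _ d] split: if_splits)
  moreover have "{xs \<in> G. \<phi> xs = c} \<subseteq> ?L" by (auto simp: G_def)
  ultimately show ?thesis using that by blast
qed

section \<open>Separating weights\<close>

text \<open>
  For the ratio \<open>t\<close>, the condition says that \<open>u a + v b + w c > 0\<close> with \<open>w = - u - v\<close> for every
  nonconstant triple of digits that may occur in a coordinate of three collinear points. Outside \<open>E\<close>
  the functions vanish, so their sums over the coordinates only depend on the multiplicities of the
  digits in \<open>E\<close>.
\<close>

definition separating :: "int \<Rightarrow> int set \<Rightarrow> int set \<Rightarrow> int \<Rightarrow> bool" where
  "separating p D E t \<longleftrightarrow> (\<exists>u v :: int \<Rightarrow> int.
     (\<forall>d\<in>D - E. u d = 0 \<and> v d = 0) \<and>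
     (\<forall>a\<in>D. \<forall>b\<in>D. \<forall>c\<in>D. [c = (1 - t) * a + t * b] (mod p) \<longrightarrow>
        a = b \<and> b = c \<or> u a - u c + (v b - v c) > 0))"

lemma separating_cong:
  assumes "[s = t] (mod p)" "separating p D E s"
  shows "separating p D E t"
proof -
  have "[(1 - t) * a + t * b = (1 - s) * a + s * b] (mod p)" for a b
    using assms(1) by (intro cong_add cong_mult cong_diff) (auto simp: cong_sym)
  then have "[c = (1 - t) * a + t * b] (mod p) \<longleftrightarrow> [c = (1 - s) * a + s * b] (mod p)" for a b c
    by (meson cong_sym cong_trans)
  then show ?thesis using assms(2) unfolding separating_def by simp
qed

text \<open>Passing from \<open>t\<close> to \<open>1 - t\<close> exchanges \<open>a\<close> and
  \<open>b\<close>, hence the weights \<open>u\<close> and \<open>v\<close>.\<close>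

lemma separating_complement:
  assumes "separating p D E t"
  shows "separating p D E (1 - t)"
proof -
  obtain u v where uv: "\<forall>d\<in>D - E. u d = 0 \<and> v d = 0"
     "\<forall>a\<in>D. \<forall>b\<in>D. \<forall>c\<in>D. [c = (1 - t) * a + t * b] (mod p) \<longrightarrow>
        a = b \<and> b = c \<or> u a - u c + (v b - v c) > (0 :: int)"
    using assms unfolding separating_def by blast
  show ?thesis
    unfolding separating_def
  proof (rule exI[of _ v], rule exI[of _ u], intro conjI ballI impI)
    fix a b c assume *: "a \<in> D" "b \<in> D" "c \<in> D" "[c = (1 - (1 - t)) * a + (1 - t) * b] (mod p)"
    then have "[c = (1 - t) * b + t * a] (mod p)" by (simp add: algebra_simps)
    then have "b = a \<and> a = c \<or> u b - u c + (v a - v c) > 0" using uv(2) *(1-3) by blast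
    then show "a = b \<and> b = c \<or> v a - v c + (u b - u c) > 0" by auto
  qed (use uv in auto)
qed

text \<open>Passing from \<open>t\<close> to its inverse exchanges \<open>b\<close> and
  \<open>c\<close>, hence \<open>v\<close> and the third weight \<open>- u - v\<close>.\<close>

lemma separating_inverse:
  assumes "[t * s = 1] (mod p)" "separating p D E t"
  shows "separating p D E s"
proof -
  obtain u v where uv: "\<forall>d\<in>D - E. u d = 0 \<and> v d = 0"
     "\<forall>a\<in>D. \<forall>b\<in>D. \<forall>c\<in>D. [c = (1 - t) * a + t * b] (mod p) \<longrightarrow>
        a = b \<and> b = c \<or> u a - u c + (v b - v c) > (0 :: int)"
    using assms unfolding separating_def by blast
  show ?thesis
    unfolding separating_def
  proof (rule exI[of _ u], rule exI[of _ "\<lambda>d. - u d - v d"], intro conjI ballI impI)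
    fix a b c assume *: "a \<in> D" "b \<in> D" "c \<in> D" "[c = (1 - s) * a + s * b] (mod p)"
    have "[(1 - t) * a + t * c = (1 - t) * a + t * ((1 - s) * a + s * b)] (mod p)"
      using *(4) by (intro cong_add cong_mult) auto
    also have "(1 - t) * a + t * ((1 - s) * a + s * b) = a + t * s * (b - a)" by (simp add: algebra_simps)
    also have "[\<dots> = a + 1 * (b - a)] (mod p)" using assms(1) by (intro cong_add cong_mult) auto
    finally have "[b = (1 - t) * a + t * c] (mod p)" by (simp add: cong_sym)
    then have "a = c \<and> c = b \<or> u a - u b + (v c - v b) > 0" using uv(2) *(1-3) by blast
    then show "a = b \<and> b = c \<or> u a - u c + (- u b - v b - (- u c - v c)) > 0" by auto
  qed (use uv in auto)
qed

lemma separating_collinear_eq: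
  assumes sep: "separating p D E t" and fin: "finite D" "E \<subseteq> D"
    and D: "set xs \<subseteq> D" "set ys \<subseteq> D" "set zs \<subseteq> D"
    and len: "length xs = n" "length ys = n" "length zs = n"
    and count: "\<And>d. d \<in> E \<Longrightarrow> count_list xs d = count_list ys d"
      "\<And>d. d \<in> E \<Longrightarrow> count_list ys d = count_list zs d"
    and coll: "\<And>i. i < n \<Longrightarrow> [zs ! i = (1 - t) * xs ! i + t * ys ! i] (mod p)"
  shows "xs = ys"
proof -
  obtain u v where uv: "\<forall>d\<in>D - E. u d = 0 \<and> v d = 0"
     "\<forall>a\<in>D. \<forall>b\<in>D. \<forall>c\<in>D. [c = (1 - t) * a + t * b] (mod p) \<longrightarrow>
        a = b \<and> b = c \<or> u a - u c + (v b - v c) > (0 :: int)"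
    using sep unfolding separating_def by blast
  have total: "(\<Sum>i<n. w (ws ! i)) = (\<Sum>d\<in>E. int (count_list ws d) * w d)"
    if "set ws \<subseteq> D" "length ws = n" "\<forall>d\<in>D - E. w d = 0" for w :: "int \<Rightarrow> int" and ws
  proof -
    have "(\<Sum>i<n. w (ws ! i)) = sum_list (map w ws)"
      using that(2) by (simp add: sum_list_sum_nth atLeast0LessThan)
    also have "\<dots> = (\<Sum>d\<in>D. int (count_list ws d) * w d)"
      using that(1) fin(1)
    proof (induction ws)
      case (Cons a ws)
      have "(\<Sum>d\<in>D. int (count_list (a # ws) d) * w d)
          = (\<Sum>d\<in>D. (if d = a then w a else 0) + int (count_list ws d) * w d)"
        by (intro sum.cong) (auto simp: algebra_simps)
      then show ?case using Cons by (simp add: sum.distrib)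
    qed simp
    also have "\<dots> = (\<Sum>d\<in>E. int (count_list ws d) * w d)"
      using that(3) fin by (intro sum.mono_neutral_right) auto
    finally show ?thesis .
  qed
  define f where "f i = u (xs ! i) - u (zs ! i) + (v (ys ! i) - v (zs ! i))" for i
  have mem: "xs ! i \<in> D" "ys ! i \<in> D" "zs ! i \<in> D" if "i < n" for i
    using D len that nth_mem[of i xs] nth_mem[of i ys] nth_mem[of i zs] by auto
  have dich: "xs ! i = ys ! i \<and> ys ! i = zs ! i \<or> f i > 0" if "i < n" for i
    using uv(2) mem[OF that] coll[OF that] unfolding f_def by blast
  then have nonneg: "f i \<ge> 0" if "i < n" for i using that unfolding f_def by fastforce
  \<comment> \<open>By \<open>total\<close>, each weight has the same sum over all three words,
    since their multiplicities on \<open>E\<close> agree.\<close>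
  have "(\<Sum>i<n. f i) = 0"
    using uv(1) D len count by (simp add: f_def sum.distrib sum_subtractf total)
  then have "\<forall>i<n. f i = 0" using nonneg by (subst (asm) sum_nonneg_eq_0_iff) auto
  then have "xs ! i = ys ! i" if "i < n" for i using dich[OF that] that by auto
  then show ?thesis using len by (auto intro: nth_equalityI)
qed

section \<open>From separating weights to projective caps\<close>

text \<open>If one coefficient of the dependence vanished mod \<open>p\<close>, the other two would
  be opposite and nonzero, and two of the words would coincide. So all three are units; scaling
  \<open>c\<close> to \<open>-1\<close> writes \<open>zs\<close> as an affine combination of
  \<open>xs\<close> and \<open>ys\<close>.\<close>

lemma projective_cap_of_count_class:
  assumes prime: "prime p" and D: "D \<subseteq> {0..<int p}" and E: "E \<subseteq> D"
    and sep: "\<And>t. t \<in> {2..<int p} \<Longrightarrow> separating (int p) D E t"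
    and S: "S \<subseteq> {xs. set xs \<subseteq> D \<and> length xs = n}"
    and count: "\<And>xs ys d. xs \<in> S \<Longrightarrow> ys \<in> S \<Longrightarrow> d \<in> E \<Longrightarrow> count_list xs d = count_list ys d"
  shows "projective_cap n p (proj_point n p ` S)"
  unfolding projective_cap_def
proof (intro conjI ballI impI notI)
  show "proj_point n p ` S \<subseteq> PG_points n p"
    using S D proj_point_in_PG_points[OF prime] by blast
next
  fix P Q R
  assume "P \<in> proj_point n p ` S" "Q \<in> proj_point n p ` S" "R \<in> proj_point n p ` S"
    and neq: "P \<noteq> Q \<and> P \<noteq> R \<and> Q \<noteq> R"
    and line: "\<exists>L\<in>PG_lines n p. P \<subseteq> L \<and> Q \<subseteq> L \<and> R \<subseteq> L"
  then obtain xs ys zs where S3: "xs \<in> S" "ys \<in> S" "zs \<in> S"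
    and PQR: "P = proj_point n p xs" "Q = proj_point n p ys" "R = proj_point n p zs" by blast
  have neq': "xs \<noteq> ys" "xs \<noteq> zs" "ys \<noteq> zs" using neq PQR by auto
  have in_D: "set xs \<subseteq> D" "set ys \<subseteq> D" "set zs \<subseteq> D"
    and len: "length xs = n" "length ys = n" "length zs = n" using S S3 by auto
  have in_p: "set xs \<subseteq> {0..<int p}" "set ys \<subseteq> {0..<int p}" "set zs \<subseteq> {0..<int p}" using in_D D by auto
  obtain a b c where sum0: "[a + b + c = 0] (mod int p)"
    and dep: "\<And>i. i < n \<Longrightarrow> [a * xs ! i + b * ys ! i + c * zs ! i = 0] (mod int p)"
    and nz: "\<not> int p dvd a \<or> \<not> int p dvd b \<or> \<not> int p dvd c"
    using line collinear_imp_dependent[OF prime in_p(1) len(1) in_p(2) len(2) in_p(3) len(3) neq']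
    unfolding PQR by blast
  have pi: "prime (int p)" using prime by simp
  have two: "vs = ws"
    if "\<not> int p dvd e" "\<And>i. i < n \<Longrightarrow> int p dvd e * (vs ! i - ws ! i)"
      "set vs \<subseteq> {0..<int p}" "set ws \<subseteq> {0..<int p}" "length vs = n" "length ws = n" for e vs ws
  proof (rule nth_equalityI)
    fix i assume "i < length vs"
    then have i: "i < n" using that by simp
    then have "int p dvd vs ! i - ws ! i" using that(1,2) prime_dvd_mult_iff[OF pi] by blast
    then have "vs ! i mod int p = ws ! i mod int p" by (simp add: mod_eq_dvd_iff)
    moreover have "vs ! i \<in> {0..<int p}" "ws ! i \<in> {0..<int p}" using subsetD[OF that(3) nth_mem[of i vs]] subsetD[OF that(4) nth_mem[of i ws]] i that(5,6) by auto
    ultimately show "vs ! i = ws ! i" by simp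
  qed (use that in simp)
  have sum0': "int p dvd a + b + c" using sum0 by (simp add: cong_0_iff)
  have dep': "int p dvd a * xs ! i + b * ys ! i + c * zs ! i" if "i < n" for i
    using dep[OF that] by (simp add: cong_0_iff)
  have na: "\<not> int p dvd a"
  proof
    assume a: "int p dvd a"
    then have bc: "int p dvd b + c" using sum0' by (simp add: add.assoc dvd_add_right_iff)
    then have b: "\<not> int p dvd b" using nz a dvd_add_right_iff by blast
    have "int p dvd b * (ys ! i - zs ! i)" if "i < n" for i
    proof -
      have "b * (ys ! i - zs ! i) = (a * xs ! i + b * ys ! i + c * zs ! i) - a * xs ! i - (b + c) * zs ! i"
        by (simp add: algebra_simps)
      then show ?thesis by (simp only:) (intro dvd_diff dvd_mult2 dep' that a bc)
    qed
    from two[OF b this in_p(2,3) len(2,3)] show False using neq' by simp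
  qed
  have nb: "\<not> int p dvd b"
  proof
    assume b: "int p dvd b"
    then have ac: "int p dvd a + c" using sum0' dvd_add_left_iff[of "int p" b "a + c"] by (simp add: ac_simps)
    have "int p dvd a * (xs ! i - zs ! i)" if "i < n" for i
    proof -
      have "a * (xs ! i - zs ! i) = (a * xs ! i + b * ys ! i + c * zs ! i) - b * ys ! i - (a + c) * zs ! i"
        by (simp add: algebra_simps)
      then show ?thesis by (simp only:) (intro dvd_diff dvd_mult2 dep' that b ac)
    qed
    from two[OF na this in_p(1,3) len(1,3)] show False using neq' by simp
  qed
  have nc: "\<not> int p dvd c"
  proof
    assume c: "int p dvd c"
    then have ab: "int p dvd a + b" using sum0' by (simp add: dvd_add_left_iff)
    have "int p dvd a * (xs ! i - ys ! i)" if "i < n" for i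
    proof -
      have "a * (xs ! i - ys ! i) = (a * xs ! i + b * ys ! i + c * zs ! i) - c * zs ! i - (a + b) * ys ! i"
        by (simp add: algebra_simps)
      then show ?thesis by (simp only:) (intro dvd_diff dvd_mult2 dep' that c ab)
    qed
    from two[OF na this in_p(1,2) len(1,2)] show False using neq' by simp
  qed
  have "coprime (- c) (int p)"
    using prime_imp_coprime[OF pi nc] by (simp add: coprime_commute)
  then obtain e where e: "[- c * e = 1] (mod int p)" using cong_solve_coprime_int by blast
  have ce: "int p dvd 1 + c * e" using e by (simp add: cong_iff_dvd_diff dvd_diff_commute)
  have ne: "\<not> int p dvd e"
  proof
    assume "int p dvd e"
    then have "int p dvd 1" using ce by (simp add: dvd_add_left_iff)
    then show False using pi not_prime_unit by blast
  qed
  \<comment> \<open>Since \<open>a * e + b * e\<close> is 1 mod \<open>p\<close>, the ratio is not 0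
    because \<open>b\<close> is a unit and not 1 because \<open>a\<close> is one. Reduction mod
    \<open>p\<close> brings it into the range where \<open>sep\<close> applies.\<close>
  define t where "t = (b * e) mod int p"
  have t: "[t = b * e] (mod int p)" by (simp add: t_def)
  have "0 \<le> t" "t < int p" using prime_gt_0_nat[OF prime] by (auto simp: t_def)
  moreover have "t \<noteq> 0" using nb ne pi by (auto simp: t_def prime_dvd_mult_iff)
  moreover have "t \<noteq> 1"
  proof
    assume "t = 1"
    then have be: "int p dvd 1 - b * e" using t by (simp add: cong_iff_dvd_diff)
    have eq: "a * e = (a + b + c) * e + (1 - b * e) - (1 + c * e)" by (simp add: algebra_simps)
    have "int p dvd a * e"
      unfolding eq by (rule dvd_diff[OF dvd_add[OF dvd_mult2[OF sum0'] be] ce])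
    then show False using na ne pi by (simp add: prime_dvd_mult_iff)
  qed
  ultimately have "t \<in> {2..<int p}" by auto
  then have "separating (int p) D E (b * e)" using separating_cong[OF t] sep by blast
  then have "xs = ys"
  proof (rule separating_collinear_eq[OF _ _ E in_D len])
    show "finite D" using D finite_subset by blast
    show "count_list xs d = count_list ys d" "count_list ys d = count_list zs d" if "d \<in> E" for d
      by (rule count[OF _ _ that]; fact)+
    show "[zs ! i = (1 - b * e) * xs ! i + b * e * ys ! i] (mod int p)" if "i < n" for i
    proof -
      \<comment> \<open>An exact integer identity in which every summand on the right contains a
        factor divisible by \<open>p\<close>.\<close>
      have eq: "zs ! i - ((1 - b * e) * xs ! i + b * e * ys ! i) =
          (1 + c * e) * (zs ! i - xs ! i) - (a * xs ! i + b * ys ! i + c * zs ! i) * e + (a + b + c) * (e * xs ! i)"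
        by (simp add: algebra_simps)
      have "int p dvd zs ! i - ((1 - b * e) * xs ! i + b * e * ys ! i)"
        unfolding eq
        by (rule dvd_add[OF dvd_diff[OF dvd_mult2[OF ce] dvd_mult2[OF dep'[OF that]]] dvd_mult2[OF sum0']])
      then show ?thesis by (simp add: cong_iff_dvd_diff)
    qed
  qed
  then show False using neq' by simp
qed

section \<open>Certificates\<close>

text \<open>The default 0 builds in the vanishing outside \<open>E\<close> that
  \<open>separating\<close> demands.\<close>

definition weight :: "int list \<Rightarrow> int list \<Rightarrow> int \<Rightarrow> int" where
  "weight es ws d = (case map_of (zip es ws) d of None \<Rightarrow> 0 | Some w \<Rightarrow> w)"

text \<open>The digits being reduced, \<open>c\<close> is determined by \<open>a\<close> and
  \<open>b\<close>, so computing it replaces a quantifier. For \<open>a = b\<close> the triple is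
  constant.\<close>

definition is_certificate :: "int \<Rightarrow> int list \<Rightarrow> int list \<Rightarrow> int \<times> int list \<times> int list \<Rightarrow> bool" where
  "is_certificate p ds es = (\<lambda>(t, us, vs). \<forall>a\<in>set ds. \<forall>b\<in>set ds. a \<noteq> b \<longrightarrow>
     (let c = ((1 - t) * a + t * b) mod p in c \<in> set ds \<longrightarrow>
        weight es us a - weight es us c + (weight es vs b - weight es vs c) > 0))"

text \<open>
  Permuting the three collinear points acts on the ratio by the group generated by
  \<open>t \<mapsto> 1 - t\<close> and \<open>t \<mapsto> 1 / t\<close>, so one certificate for each orbit is enough.
\<close>

definition same_orbit :: "int \<Rightarrow> int \<Rightarrow> int \<Rightarrow> bool" where
  "same_orbit p r t \<longleftrightarrow>
     t mod p = r mod p \<or> t mod p = (1 - r) mod p \<or>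
     r * t mod p = 1 \<or> (1 - r) * t mod p = 1 \<or>
     r * (1 - t) mod p = 1 \<or> (1 - r) * (1 - t) mod p = 1"

definition certified :: "int \<Rightarrow> int list \<Rightarrow> int list \<Rightarrow> (int \<times> int list \<times> int list) list \<Rightarrow> bool" where
  "certified p ds es cs \<longleftrightarrow>
     (\<forall>d\<in>set ds. 0 \<le> d \<and> d < p) \<and> list_all (is_certificate p ds es) cs \<and>
     (\<forall>t\<in>set [2..p - 1]. \<exists>c\<in>set cs. same_orbit p (fst c) t)"

lemma weight_outside: "d \<notin> set es \<Longrightarrow> weight es ws d = 0"
  by (auto simp: weight_def split: option.split dest!: map_of_SomeD set_zip_leftD)

lemma is_certificate_separating:
  assumes "is_certificate p ds es (t, us, vs)" and ds: "\<forall>d\<in>set ds. 0 \<le> d \<and> d < p"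
  shows "separating p (set ds) (set es) t"
  unfolding separating_def
proof (rule exI[of _ "weight es us"], rule exI[of _ "weight es vs"], intro conjI ballI impI)
  fix a b c
  assume abc: "a \<in> set ds" "b \<in> set ds" "c \<in> set ds" "[c = (1 - t) * a + t * b] (mod p)"
  then have c: "c = ((1 - t) * a + t * b) mod p"
    using ds abc(3) unfolding unique_euclidean_semiring_class.cong_def by (metis mod_pos_pos_trivial)
  show "a = b \<and> b = c \<or> weight es us a - weight es us c + (weight es vs b - weight es vs c) > 0"
  proof (cases "a = b")
    case True
    then have "c = a" using c abc(1) ds by (simp add: algebra_simps)
    then show ?thesis using True by simp
  next
    case False
    then show ?thesis using assms(1) abc c by (simp add: is_certificate_def Let_def)
  qed
qed (simp_all add: weight_outside)

text \<open>The six disjuncts describe \<open>t\<close> as \<open>r\<close>, \<open>1 - r\<close>,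
  \<open>1 / r\<close>, \<open>1 / (1 - r)\<close>, \<open>1 - 1 / r\<close> and
  \<open>1 - 1 / (1 - r)\<close> mod \<open>p\<close>; each is reached by complements and
  inverses.\<close>

lemma same_orbit_separating:
  assumes "same_orbit p r t" "separating p D E r" "p > 1"
  shows "separating p D E t"
proof -
  have inv: "separating p D E s" if "separating p D E q" "q * s mod p = 1" for q s
  proof (rule separating_inverse[OF _ that(1)])
    show "[q * s = 1] (mod p)" using that(2) assms(3) by (simp add: unique_euclidean_semiring_class.cong_def)
  qed
  have com: "separating p D E s" if "separating p D E (1 - s)" for s
    using separating_complement[OF that] by simp
  have con: "separating p D E s" if "separating p D E q" "s mod p = q mod p" for q s
    using separating_cong[OF _ that(1)] that(2) by (simp add: unique_euclidean_semiring_class.cong_def)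
  note r = assms(2) separating_complement[OF assms(2)]
  show ?thesis
    using assms(1) unfolding same_orbit_def
    by (elim disjE) (blast intro: con[OF r(1)], blast intro: con[OF r(2)],
      blast intro: inv[OF r(1)], blast intro: inv[OF r(2)],
      blast intro: com inv[OF r(1)], blast intro: com inv[OF r(2)])
qed

lemma certified_separating:
  assumes "certified p ds es cs" "t \<in> {2..<p}"
  shows "separating p (set ds) (set es) t"
proof -
  have "t \<in> set [2..p - 1]" using assms(2) by auto
  then obtain c where c: "c \<in> set cs" "same_orbit p (fst c) t"
    using assms(1) unfolding certified_def by blast
  have "is_certificate p ds es (fst c, fst (snd c), snd (snd c))"
    using c(1) assms(1) by (simp add: certified_def list_all_iff)
  from is_certificate_separating[OF this] show ?thesis
    using same_orbit_separating[OF c(2)] assms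
    by (simp add: certified_def)
qed

section \<open>The lower bound obtained from a certificate\<close>

text \<open>Distinct words give distinct points, so the large class of words bounds the cap from
  below. The separate name \<open>q\<close> lets certificates be stated with integer
  numerals.\<close>

lemma max_cap_gg:
  assumes prime: "prime p" and p: "int p = q" and cert: "certified q ds es cs"
    and es: "set es \<subseteq> set ds" "card (set es) < card (set ds)"
  shows "(\<lambda>n. real (max_cap n p)) \<ggreater>
         (\<lambda>n. real (card (set ds)) ^ n / real n powr (real (card (set es)) / 2))"
  unfolding vinogradov_gg_def
proof (intro exI conjI allI impI)
  let ?k = "real (card (set ds))" and ?e = "card (set es)"
  \<comment> \<open>The factor \<open>1 / ?k\<close> is the proportion of words kept, and
    \<open>3 ^ ?e\<close> comes from counting the multiplicity vectors.\<close>
  show "1 / (?k * 3 ^ ?e) > 0" using es(2) by simp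
  fix n :: nat assume n: "0 < n"
  have ds: "set ds \<subseteq> {0..<int p}" using cert p by (auto simp: certified_def)
  obtain S where S: "S \<subseteq> {xs. set xs \<subseteq> set ds \<and> length xs = n}"
      "\<And>xs ys d. xs \<in> S \<Longrightarrow> ys \<in> S \<Longrightarrow> d \<in> set es \<Longrightarrow> count_list xs d = count_list ys d"
    and card_S: "?k ^ n / ?k \<le> real (card S) * (3 * sqrt n) ^ ?e"
    by (rule exists_large_count_class[OF finite_set es n]) (rule that)
  have "projective_cap n p (proj_point n p ` S)"
    using projective_cap_of_count_class[OF prime ds es(1) certified_separating[OF cert[folded p]] S] by simp
  then have "card (proj_point n p ` S) \<le> max_cap n p" by (rule max_cap_attained(2)[OF prime])
  moreover have "inj_on (proj_point n p) S"
  proof (rule inj_onI)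
    fix xs ys assume "xs \<in> S" "ys \<in> S" "proj_point n p xs = proj_point n p ys"
    moreover from this have "set xs \<subseteq> {0..<int p}" "length xs = n" "set ys \<subseteq> {0..<int p}" "length ys = n"
      using S(1) ds by blast+
    ultimately show "xs = ys" using proj_point_eqD[OF prime] by blast
  qed
  ultimately have "real (card S) \<le> real (max_cap n p)" by (simp add: card_image)
  then have "?k ^ n / ?k \<le> real (max_cap n p) * (3 * sqrt n) ^ ?e"
    using card_S by (elim order.trans, intro mult_right_mono) auto
  moreover have "sqrt n ^ ?e = real n powr (real ?e / 2)"
    using n by (simp add: powr_half_sqrt[symmetric] powr_realpow[symmetric] powr_powr)
  ultimately have "?k ^ n / ?k \<le> real (max_cap n p) * (3 ^ ?e * real n powr (real ?e / 2))"
    by (simp add: power_mult_distrib)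
  then show "real (max_cap n p) \<ge> 1 / (?k * 3 ^ ?e) * (?k ^ n / real n powr (real ?e / 2))"
    using n es(2) by (simp add: field_simps)
qed

text \<open>
  The digit sets were found by a computer search and the weights by linear programming. In each list
  of digits, the first two are the ones whose multiplicities are not prescribed.
\<close>

lemma certified_11:
  "certified 11 [1, 2, 0, 4, 5] [0, 4, 5]
    [(10, [-2, 0, 0], [1, 0, 0]),
     (3, [0, -2, 1], [0, 1, 1])]"
  by code_simp

text \<open>The first ratio in each list is -1, whose orbit consists of -1, 2 and 1/2. All five
  primes are 2 mod 3, so \<open>t * t - t + 1\<close> has no root and every other orbit has six
  elements; hence \<open>(p + 1) / 6\<close> certificates cover the \<open>p - 2\<close>
  ratios.\<close>

lemma certified_17:
  "certified 17 [6, 10, 0, 1, 2, 3, 4] [0, 1, 2, 3, 4]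
    [(16, [-12, -6, -2, 0, 0], [6, 3, 1, 0, 0]),
     (3, [1, -1, 0, -1, 1], [-2, 0, 5, 1, 2]),
     (4, [1, 0, 2, -4, 0], [0, 0, 0, 2, -1])]"
  by code_simp

lemma certified_23:
  "certified 23 [1, 2, 0, 3, 4, 6, 7, 18, 19] [0, 3, 4, 6, 7, 18, 19]
    [(22, [-2, -2, -6, -14, -14, -13, -17], [1, 1, 3, 7, 7, 0, 2]),
     (3, [-4, -7, -1, -11, -3, -10, -7], [-8, 2, 0, 3, 0, 8, -2]),
     (4, [19, 18, 7, -12, 16, 7, -6], [-14, 8, 2, 18, 2, 9, 11]),
     (5, [-11, -9, -3, -5, -3, 1, -15], [-4, -7, -3, 4, -5, -9, 6])]"
  by code_simp

lemma certified_29: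
  "certified 29 [7, 11, 0, 1, 2, 3, 4, 16, 19, 21] [0, 1, 2, 3, 4, 16, 19, 21]
    [(28, [-108, -68, -34, -6, 0, -4, -14, -14], [54, 34, 17, 3, 0, 0, 5, 7]),
     (3, [-1, 4, 1, -1, 8, 3, 7, -4], [1, -2, 2, -3, -10, -7, -18, 2]),
     (4, [7, -9, -8, 1, 12, -15, 13, 1], [0, 16, 23, 5, 5, 21, -18, 21]),
     (5, [-14, 2, -6, -8, 0, -2, -2, 0], [8, 5, 4, 7, 1, 4, 1, 0]),
     (9, [2, 3, -2, -3, -2, 4, 4, 2], [0, 2, -2, 4, 0, 7, 1, -1])]"
  by code_simp

lemma certified_41:
  "certified 41 [19, 31, 0, 1, 2, 3, 7, 12, 15, 16, 35, 37] [0, 1, 2, 3, 7, 12, 15, 16, 35, 37]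
    [(40, [-12, -6, -2, 0, -2, -14, 0, -2, -2, 0], [6, 3, 1, 0, 1, 7, 0, 1, 1, 0]),
     (3, [-1, 4, 1, 2, 0, -6, -10, -6, 1, 1], [0, 1, -2, -3, 0, 0, 1, 4, 0, -1]),
     (4, [3, -43, 12, 22, 13, -34, 18, 3, 8, -4], [0, 22, -16, 0, -14, 12, 61, 7, -13, -4]),
     (5, [1, 8, 4, -4, -9, -10, 16, 4, 10, 6], [2, -16, 8, -2, 7, 6, -21, 0, -6, 0]),
     (6, [-2, 2, 14, 26, -7, -36, 8, 28, 72, -1], [-6, -11, 0, -70, 1, 10, -27, 0, 0, -4]),
     (12, [5, -9, 1, 1, 8, 5, -3, 6, 4, 2], [0, 0, -5, 0, -5, -15, 2, 0, -8, -3]),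
     (13, [1, -7, -8, -2, 4, 0, -17, -5, 2, 3], [0, 2, 4, 4, -3, 0, 11, 3, -3, 3])]"
  by code_simp

section \<open>Exponential growth rates and the conclusion\<close>

lemma liminf_root_ge:
  assumes "f \<ggreater> (\<lambda>n. b ^ n / real n powr e)" "b > 1"
  shows "liminf (\<lambda>n. ereal (f n powr (1 / real n))) \<ge> ereal b"
proof -
  obtain C n0 where C: "C > 0" "\<And>n. n > n0 \<Longrightarrow> f n \<ge> C * (b ^ n / real n powr e)"
    using assms(1) by (auto simp: vinogradov_gg_def)
  \<comment> \<open>The \<open>n\<close>-th roots of the constant and of the power of
    \<open>n\<close> tend to 1.\<close>
  have "(\<lambda>n. (C * (b ^ n / real n powr e)) powr (1 / real n)) \<longlonglongrightarrow> b"
    using C(1) assms(2) by real_asymp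
  then have "(\<lambda>n. ereal ((C * (b ^ n / real n powr e)) powr (1 / real n))) \<longlonglongrightarrow> ereal b"
    by simp
  then have "ereal b = liminf (\<lambda>n. ereal ((C * (b ^ n / real n powr e)) powr (1 / real n)))"
    by (metis lim_imp_Liminf sequentially_bot)
  also have "\<dots> \<le> liminf (\<lambda>n. ereal (f n powr (1 / real n)))"
  proof (rule Liminf_mono, rule eventually_mono[OF eventually_gt_at_top[of n0]])
    fix n assume "n > n0"
    then show "ereal ((C * (b ^ n / real n powr e)) powr (1 / real n)) \<le> ereal (f n powr (1 / real n))"
      using C assms(2) by (auto intro!: powr_mono2)
  qed
  finally show ?thesis .
qed

theorem corollary2:
  shows "(\<lambda>n. real (max_cap n 11)) \<ggreater> (\<lambda>n. 5 ^ n / real n powr 1.5) \<and>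
         (\<lambda>n. real (max_cap n 17)) \<ggreater> (\<lambda>n. 7 ^ n / real n powr 2.5) \<and>
         (\<lambda>n. real (max_cap n 23)) \<ggreater> (\<lambda>n. 9 ^ n / real n powr 3.5) \<and>
         (\<lambda>n. real (max_cap n 29)) \<ggreater> (\<lambda>n. 10 ^ n / real n ^ 4) \<and>
         (\<lambda>n. real (max_cap n 41)) \<ggreater> (\<lambda>n. 12 ^ n / real n ^ 5) \<and>
         liminf (\<lambda>n. ereal (real (max_cap n 11) powr (1 / real n))) \<ge> 5 \<and>
         liminf (\<lambda>n. ereal (real (max_cap n 17) powr (1 / real n))) \<ge> 7 \<and>
         liminf (\<lambda>n. ereal (real (max_cap n 23) powr (1 / real n))) \<ge> 9 \<and>
         liminf (\<lambda>n. ereal (real (max_cap n 29) powr (1 / real n))) \<ge> 10 \<and>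
         liminf (\<lambda>n. ereal (real (max_cap n 41) powr (1 / real n))) \<ge> 12"
proof -
  have 11: "(\<lambda>n. real (max_cap n 11)) \<ggreater> (\<lambda>n. 5 ^ n / real n powr 1.5)"
    using max_cap_gg[OF _ _ certified_11, of 11] by simp
  have 17: "(\<lambda>n. real (max_cap n 17)) \<ggreater> (\<lambda>n. 7 ^ n / real n powr 2.5)"
    using max_cap_gg[OF _ _ certified_17, of 17] by simp
  have 23: "(\<lambda>n. real (max_cap n 23)) \<ggreater> (\<lambda>n. 9 ^ n / real n powr 3.5)"
    using max_cap_gg[OF _ _ certified_23, of 23] by simp
  have 29: "(\<lambda>n. real (max_cap n 29)) \<ggreater> (\<lambda>n. 10 ^ n / real n powr 4)"
    using max_cap_gg[OF _ _ certified_29, of 29] by simp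
  have 41: "(\<lambda>n. real (max_cap n 41)) \<ggreater> (\<lambda>n. 12 ^ n / real n powr 5)"
    using max_cap_gg[OF _ _ certified_41, of 41] by simp
  \<comment> \<open>For the exponents 4 and 5 the real power becomes a natural one; the two agree as
    \<open>n > n0\<close> makes \<open>n\<close> positive.\<close>
  have *: "f \<ggreater> (\<lambda>n. b ^ n / real n ^ e)" if f: "f \<ggreater> (\<lambda>n. b ^ n / real n powr real e)" for f b e
  proof -
    obtain C n0 where C: "C > 0" "\<And>n. n > n0 \<Longrightarrow> f n \<ge> C * (b ^ n / real n powr real e)"
      using f unfolding vinogradov_gg_def by blast
    show ?thesis
      unfolding vinogradov_gg_def
    proof (intro exI conjI allI impI)
      show "f n \<ge> C * (b ^ n / real n ^ e)" if "n > n0" for n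
        using C(2)[OF that] that by (simp add: powr_realpow)
    qed (rule C(1))
  qed
  show ?thesis
    using 11 17 23 *[of _ 10 4] *[of _ 12 5] 29 41
      liminf_root_ge[OF 11] liminf_root_ge[OF 17] liminf_root_ge[OF 23] liminf_root_ge[OF 29] liminf_root_ge[OF 41]
    by simp
qed

end
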